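(* Let $G$ be a finite simple undirected $\delta$-regular graph of order $n\ge 1$ such that $\frac{n}{n-\delta}$ is an odd integer. Then $\kappa'(G)=\frac{n}{n-\delta}$ if and only if the complement graph $\overline G$ has a perfect code.
   Context: For a graph $G=(V,E)$ and $C\subseteq V$, let $Odd(C)=\{v\in V : |N(v)\cap C|\equiv 1 \pmod 2\}$, where $N(v)$ is the open neighborhood of $v$. A set $B\subseteq V$ is a weak odd dominated (WOD) set if there exists $C\subseteq V\setminus B$ with $B\subseteq Odd(C)$. $\kappa'(G)$ is the minimum size of a subset of $V$ that is not a WOD set. $\overline G$ is the complement graph of $G$. A perfect code of a graph with vertex set $V$ is a set $C\subseteq V$ such that $C$ is an independent set and every vertex in $V\setminus C$ has exactly one neighbor in $C$. *)

theory Defs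
  imports Complex_Main "Graph_Theory.Pair_Digraph"
begin

text \<open>
  Finite simple undirected graphs are the locale \<^locale>\<open>pair_graph\<close>: finite, loop-free,
  symmetric digraphs without parallel arcs. An undirected edge between u and v is the pair
  of arcs (u,v) and (v,u), so the degree of a vertex is its out-degree. The empty graph is
  allowed by the locale.
\<close>

definition neighborhood :: "'a pair_pre_digraph \<Rightarrow> 'a \<Rightarrow> 'a set" where
  "neighborhood G v = {u. (v, u) \<in> parcs G}"

definition regular :: "'a pair_pre_digraph \<Rightarrow> nat \<Rightarrow> bool" where
  "regular G d \<longleftrightarrow> (\<forall>v \<in> pverts G. out_degree (with_proj G) v = d)"

definition complement :: "'a pair_pre_digraph \<Rightarrow> 'a pair_pre_digraph" where
  "complement G = \<lparr> pverts = pverts G,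
     parcs = {(u, v). u \<in> pverts G \<and> v \<in> pverts G \<and> u \<noteq> v \<and> (u, v) \<notin> parcs G} \<rparr>"

definition odd_set :: "'a pair_pre_digraph \<Rightarrow> 'a set \<Rightarrow> 'a set" where
  "odd_set G C = {v \<in> pverts G. odd (card (neighborhood G v \<inter> C))}"

definition WOD :: "'a pair_pre_digraph \<Rightarrow> 'a set \<Rightarrow> bool" where
  "WOD G B \<longleftrightarrow> B \<subseteq> pverts G \<and> (\<exists>C \<subseteq> pverts G - B. B \<subseteq> odd_set G C)"

definition kappa' :: "'a pair_pre_digraph \<Rightarrow> nat" where
  "kappa' G = Min {card B | B. B \<subseteq> pverts G \<and> \<not> WOD G B}"

definition independent :: "'a pair_pre_digraph \<Rightarrow> 'a set \<Rightarrow> bool" where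
  "independent G C \<longleftrightarrow> C \<subseteq> pverts G \<and> (\<forall>u \<in> C. \<forall>v \<in> C. (u, v) \<notin> parcs G)"

definition perfect_code :: "'a pair_pre_digraph \<Rightarrow> 'a set \<Rightarrow> bool" where
  "perfect_code G C \<longleftrightarrow>
     independent G C \<and> (\<forall>v \<in> pverts G - C. card (neighborhood G v \<inter> C) = 1)"

lemma pair_graph_complement:
  assumes "pair_graph G"
  shows "pair_graph (complement G)"
proof -
  interpret pair_graph G by fact
  have sub: "parcs (complement G) \<subseteq> pverts G \<times> pverts G"
    by (auto simp: complement_def)
  have fin: "finite (parcs (complement G))"
    using sub pair_finite_verts by (meson finite_SigmaI finite_subset)
  have symG: "(v, u) \<in> parcs G" if "(u, v) \<in> parcs G" for u v
    using that pair_sym_arcs by (auto simp: symmetric_def dest: symD)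
  show ?thesis
    using sub fin pair_finite_verts
    by unfold_locales
       (auto simp: symmetric_def complement_def dest: symG intro!: symI)
qed

lemma card_neighborhood:
  "card (neighborhood G v) = out_degree (with_proj G) v"
proof -
  have "out_arcs (with_proj G) v = Pair v ` neighborhood G v"
    by (auto simp: out_arcs_def neighborhood_def)
  then show ?thesis
    by (simp add: out_degree_def card_image inj_on_def)
qed

text \<open>
  The set in the definition of \<^const>\<open>kappa'\<close> is finite and, for a nonempty graph, nonempty,
  so that \<^const>\<open>Min\<close> is meaningful there.
\<close>

lemma finite_non_WOD_cards:
  assumes "finite (pverts G)"
  shows "finite {card B | B. B \<subseteq> pverts G \<and> \<not> WOD G B}"
  using assms by simp

lemma not_WOD_pverts:
  assumes "pverts G \<noteq> {}"
  shows "\<not> WOD G (pverts G)"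
  using assms by (auto simp: WOD_def odd_set_def)

end

theory Submission
  imports Defs
begin

text \<open>
  Over the field with two elements, \<open>B\<close> is WOD iff the linear system saying that every vertex of
  \<open>B\<close> has an odd number of neighbours in \<open>C \<subseteq> V - B\<close> is solvable. By duality, \<open>B\<close> is not WOD iff
  some \<open>D \<subseteq> B\<close> of odd size satisfies \<open>Odd(D) \<subseteq> B\<close>. A vertex outside \<open>B\<close> then has an even number
  of neighbours among the odd number of vertices in \<open>D\<close>, so it has a non-neighbour in \<open>D\<close>. The sets
  of non-neighbours have \<open>n - \<delta>\<close> elements and contain their own vertex; counting pairs gives
  \<open>n \<le> |D| (n - \<delta>) + |B - D| \<le> |B| (n - \<delta>)\<close>. If equality holds and \<open>n - \<delta> > 1\<close>, then \<open>B = D\<close> and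
  every vertex has exactly one non-neighbour in \<open>D\<close>, that is, \<open>D\<close> is a perfect code of the
  complement. If \<open>n - \<delta> = 1\<close>, then the complement has no edges.
  Conversely, a perfect code of the complement has the odd size \<open>n / (n - \<delta>)\<close>, and \<open>D = B\<close> equal to
  that code shows that it is not WOD.
\<close>

section \<open>Parity of cardinalities and linear systems over the field with two elements\<close>

lemma even_card_Un_Diff_Int:
  assumes "finite A" "finite B"
  shows "even (card ((A - B) \<union> (B - A))) \<longleftrightarrow> (even (card A) \<longleftrightarrow> even (card B))"
proof -
  have "card A = card (A - B) + card (A \<inter> B)" "card B = card (B - A) + card (A \<inter> B)"
    using card_Int_Diff[OF assms(1), of B] card_Int_Diff[OF assms(2), of A]
    by (simp_all add: Int_commute)
  moreover have "card ((A - B) \<union> (B - A)) = card (A - B) + card (B - A)"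
    using assms by (intro card_Un_disjoint) auto
  ultimately show ?thesis by auto
qed

lemma even_card_filter_sym_diff:
  assumes "finite A" "finite B"
  shows "even (card {b \<in> (A - B) \<union> (B - A). P b}) \<longleftrightarrow>
    (even (card {b \<in> A. P b}) \<longleftrightarrow> even (card {b \<in> B. P b}))"
proof -
  have "{b \<in> (A - B) \<union> (B - A). P b} =
      ({b \<in> A. P b} - {b \<in> B. P b}) \<union> ({b \<in> B. P b} - {b \<in> A. P b})"
    by auto
  then show ?thesis
    using even_card_Un_Diff_Int[of "{b \<in> A. P b}" "{b \<in> B. P b}"] assms by simp
qed

text \<open>
  Solvability of linear systems over the field with two elements: \<open>R\<close> is the matrix, with rows
  \<open>B\<close> and columns \<open>U\<close>, \<open>t\<close> the right-hand side, \<open>C\<close> a solution and \<open>D\<close> a certificate of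
  unsolvability.
\<close>

lemma parity_alternative:
  assumes "finite U" "finite B"
  shows "(\<exists>C\<subseteq>U. \<forall>b\<in>B. odd (card {u \<in> C. R b u}) \<longleftrightarrow> t b) \<or>
    (\<exists>D\<subseteq>B. odd (card {b \<in> D. t b}) \<and> (\<forall>u\<in>U. even (card {b \<in> D. R b u})))"
  using assms(1)
proof (induction U arbitrary: t)
  case empty
  show ?case
  proof (cases "\<exists>b\<in>B. t b")
    case True
    then obtain b where "b \<in> B" "t b" by blast
    then have "{b} \<subseteq> B" "{x \<in> {b}. t x} = {b}" by auto
    then show ?thesis by (intro disjI2 exI[of _ "{b}"]) auto
  qed auto
next
  case (insert w U)
  \<comment> \<open>The right-hand side that remains after setting the unknown of the new column
    \<open>w\<close> to one; setting it to zero leaves \<open>t\<close>. Both smaller systems must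
    be unsolvable.\<close>
  define t' where "t' b \<longleftrightarrow> t b \<noteq> R b w" for b
  show ?case
  proof (rule ccontr)
    assume contra: "\<not> ?case"
    have no: False if "C \<subseteq> insert w U" "\<forall>b\<in>B. odd (card {u \<in> C. R b u}) \<longleftrightarrow> t b" for C
      using that contra by blast
    have no': False if "D \<subseteq> B" "odd (card {b \<in> D. t b})"
      "\<forall>u\<in>U. even (card {b \<in> D. R b u})" "even (card {b \<in> D. R b w})" for D
      using that contra by blast
    have "\<not> (\<exists>C\<subseteq>U. \<forall>b\<in>B. odd (card {u \<in> C. R b u}) \<longleftrightarrow> t b)"
      using no by blast
    with insert.IH[of t] obtain D1 where D1: "D1 \<subseteq> B" "odd (card {b \<in> D1. t b})"
      "\<forall>u\<in>U. even (card {b \<in> D1. R b u})" by blast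
    have "\<not> (\<exists>C\<subseteq>U. \<forall>b\<in>B. odd (card {u \<in> C. R b u}) \<longleftrightarrow> t' b)"
    proof
      assume "\<exists>C\<subseteq>U. \<forall>b\<in>B. odd (card {u \<in> C. R b u}) \<longleftrightarrow> t' b"
      then obtain C where C: "C \<subseteq> U" "\<forall>b\<in>B. odd (card {u \<in> C. R b u}) \<longleftrightarrow> t' b" by blast
      then have "finite C" "w \<notin> C" using insert.hyps finite_subset by auto
      have "odd (card {u \<in> insert w C. R b u}) \<longleftrightarrow> t b" if "b \<in> B" for b
      proof -
        have "{u \<in> insert w C. R b u} =
            (if R b w then insert w {u \<in> C. R b u} else {u \<in> C. R b u})" by auto
        then show ?thesis using C(2) that \<open>finite C\<close> \<open>w \<notin> C\<close> by (auto simp: t'_def)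
      qed
      then show False using no[of "insert w C"] C(1) by blast
    qed
    with insert.IH[of t'] obtain D2 where D2: "D2 \<subseteq> B" "odd (card {b \<in> D2. t' b})"
      "\<forall>u\<in>U. even (card {b \<in> D2. R b u})" by blast
    have fin: "finite D1" "finite D2" using D1(1) D2(1) assms(2) finite_subset by auto
    have "odd (card {b \<in> D1. R b w})" using no' D1 by blast
    have "{b \<in> D2. t' b} =
        ({b \<in> D2. t b} - {b \<in> D2. R b w}) \<union> ({b \<in> D2. R b w} - {b \<in> D2. t b})"
      by (auto simp: t'_def)
    then have "odd (card {b \<in> D2. t b}) \<noteq> odd (card {b \<in> D2. R b w})"
      using D2(2) even_card_Un_Diff_Int[of "{b \<in> D2. t b}" "{b \<in> D2. R b w}"] fin by auto
    then have "odd (card {b \<in> D2. R b w})" "even (card {b \<in> D2. t b})"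
      using no' D2 by blast+
    \<comment> \<open>Symmetric difference adds the two certificates: in column \<open>w\<close> odd
      plus odd is even, against \<open>t\<close> odd plus even stays odd, and the columns in
      \<open>U\<close> stay even.\<close>
    then show False
      using no'[of "(D1 - D2) \<union> (D2 - D1)"] D1 D2 fin \<open>odd (card {b \<in> D1. R b w})\<close>
      by (auto simp only: even_card_filter_sym_diff)
  qed
qed

section \<open>Duality for WOD sets and perfect codes of the complement\<close>

context pair_graph
begin

lemma neighborhood_sym: "u \<in> neighborhood G v \<longleftrightarrow> v \<in> neighborhood G u"
  using pair_sym_arcs by (auto simp: neighborhood_def symmetric_def dest: symD)

lemma neighborhood_subset: "neighborhood G v \<subseteq> pverts G"
  by (auto simp: neighborhood_def dest: in_arcsD2)

lemma not_in_neighborhood: "v \<notin> neighborhood G v"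
  using pair_no_loops[of "(v, v)"] by (auto simp: neighborhood_def)

text \<open>From left to right, this is the alternative for rows \<open>B\<close>, columns
  \<open>pverts G - B\<close> and the all-ones right-hand side; symmetry of adjacency turns its
  certificate into \<open>odd_set G D \<subseteq> B\<close>.\<close>

lemma not_WOD_iff:
  assumes "B \<subseteq> pverts G"
  shows "\<not> WOD G B \<longleftrightarrow> (\<exists>D\<subseteq>B. odd (card D) \<and> odd_set G D \<subseteq> B)"
proof
  assume "\<not> WOD G B"
  have fin: "finite (pverts G - B)" "finite B"
    using finite_subset[OF assms pair_finite_verts] by auto
  have Int_eq: "neighborhood G b \<inter> C = {u \<in> C. u \<in> neighborhood G b}" for b C by auto
  have "\<not> (\<exists>C\<subseteq>pverts G - B. \<forall>b\<in>B. odd (card {u \<in> C. u \<in> neighborhood G b}) \<longleftrightarrow> True)"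
    using \<open>\<not> WOD G B\<close> assms unfolding WOD_def odd_set_def Int_eq by blast
  with parity_alternative[OF fin, of "\<lambda>b u. u \<in> neighborhood G b" "\<lambda>_. True"]
  obtain D where D: "D \<subseteq> B" "odd (card {b \<in> D. True})"
    "\<forall>u\<in>pverts G - B. even (card {b \<in> D. u \<in> neighborhood G b})" by blast
  have "{b \<in> D. u \<in> neighborhood G b} = neighborhood G u \<inter> D" for u
    by (auto simp: neighborhood_sym[of u])
  then have "odd_set G D \<subseteq> B" using D(3) by (auto simp: odd_set_def)
  then show "\<exists>D\<subseteq>B. odd (card D) \<and> odd_set G D \<subseteq> B" using D by auto
next
  assume "\<exists>D\<subseteq>B. odd (card D) \<and> odd_set G D \<subseteq> B"
  then obtain D where D: "D \<subseteq> B" "odd (card D)" "odd_set G D \<subseteq> B" by blast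
  show "\<not> WOD G B"
  proof
    assume "WOD G B"
    then obtain C where C: "C \<subseteq> pverts G - B" "B \<subseteq> odd_set G C" by (auto simp: WOD_def)
    have fin: "finite C" "finite D"
      using C(1) D(1) assms finite_subset[OF _ pair_finite_verts] by blast+
    \<comment> \<open>Edges between \<open>C\<close> and \<open>D\<close> are counted from both
      ends: the count is even seen from \<open>C\<close>, and odd seen from \<open>D\<close>, as a
      sum of an odd number of odd terms.\<close>
    have "(\<Sum>d\<in>D. card {c \<in> C. c \<in> neighborhood G d}) = (\<Sum>c\<in>C. card (neighborhood G c \<inter> D))"
    proof (intro sum_multicount_gen ballI)
      fix c
      have "{d \<in> D. c \<in> neighborhood G d} = neighborhood G c \<inter> D"
        by (auto simp: neighborhood_sym[of c])
      then show "card {d \<in> D. c \<in> neighborhood G d} = card (neighborhood G c \<inter> D)" by simp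
    qed (use fin in auto)
    moreover have "even (\<Sum>c\<in>C. card (neighborhood G c \<inter> D))"
      using C(1) D(3) by (intro dvd_sum) (auto simp: odd_set_def)
    moreover have "odd (card {c \<in> C. c \<in> neighborhood G d})" if "d \<in> D" for d
    proof -
      have "{c \<in> C. c \<in> neighborhood G d} = neighborhood G d \<inter> C" by auto
      then show ?thesis using that D(1) C(2) by (auto simp: odd_set_def)
    qed
    then have "{d \<in> D. odd (card {c \<in> C. c \<in> neighborhood G d})} = D" by blast
    then have "odd (\<Sum>d\<in>D. card {c \<in> C. c \<in> neighborhood G d})"
      using D(2) fin by (simp add: even_sum_iff)
    ultimately show False by simp
  qed
qed

text \<open>Every vertex is its own non-neighbour. So for \<open>v\<close> in \<open>C\<close>
  independence says that \<open>v\<close> is the only non-neighbour in \<open>C\<close>, and both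
  clauses of the definition merge into one count.\<close>

lemma perfect_code_complement_iff:
  "perfect_code (complement G) C \<longleftrightarrow>
    C \<subseteq> pverts G \<and> (\<forall>v\<in>pverts G. card ((pverts G - neighborhood G v) \<inter> C) = 1)"
proof (cases "C \<subseteq> pverts G")
  case C: True
  have outside: "neighborhood (complement G) v \<inter> C = (pverts G - neighborhood G v) \<inter> C"
    if "v \<in> pverts G - C" for v
    using that by (auto simp: neighborhood_def complement_def)
  have inside: "(\<forall>u\<in>C. (v, u) \<notin> parcs (complement G)) \<longleftrightarrow>
      card ((pverts G - neighborhood G v) \<inter> C) = 1" if "v \<in> C" for v
  proof -
    have v: "v \<in> (pverts G - neighborhood G v) \<inter> C"
      using that C not_in_neighborhood by auto
    have "(\<forall>u\<in>C. (v, u) \<notin> parcs (complement G)) \<longleftrightarrow>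
        (pverts G - neighborhood G v) \<inter> C = {v}"
      using C that v by (auto simp: neighborhood_def complement_def)
    also have "\<dots> \<longleftrightarrow> card ((pverts G - neighborhood G v) \<inter> C) = 1"
      using v unfolding One_nat_def card_1_singleton_iff by (metis singletonD)
    finally show ?thesis .
  qed
  have "perfect_code (complement G) C \<longleftrightarrow>
      (\<forall>v\<in>C. card ((pverts G - neighborhood G v) \<inter> C) = 1) \<and>
      (\<forall>v\<in>pverts G - C. card ((pverts G - neighborhood G v) \<inter> C) = 1)"
    using C inside outside by (simp add: perfect_code_def independent_def complement_def)
  then show ?thesis using C by blast
qed (auto simp: perfect_code_def independent_def complement_def)

text \<open>Each vertex is adjacent to all but one of the oddly many code vertices, hence to an even
  number, so \<open>odd_set G C\<close> is empty and \<open>C\<close> is its own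
  certificate.\<close>

lemma perfect_code_complement_not_WOD:
  assumes "perfect_code (complement G) C" "odd (card C)"
  shows "\<not> WOD G C"
proof -
  have C: "C \<subseteq> pverts G" "\<And>v. v \<in> pverts G \<Longrightarrow> card ((pverts G - neighborhood G v) \<inter> C) = 1"
    using assms(1) by (auto simp: perfect_code_complement_iff)
  have fin: "finite C" using finite_subset[OF C(1) pair_finite_verts] .
  have "even (card (neighborhood G v \<inter> C))" if "v \<in> pverts G" for v
  proof -
    have "C - neighborhood G v = (pverts G - neighborhood G v) \<inter> C"
      using C(1) by blast
    then have "card C = card (neighborhood G v \<inter> C) + card ((pverts G - neighborhood G v) \<inter> C)"
      using card_Int_Diff[OF fin, of "neighborhood G v"] by (simp add: Int_commute)
    then show ?thesis using C(2)[OF that] assms(2) by simp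
  qed
  then have "odd_set G C \<subseteq> C" by (auto simp: odd_set_def)
  then show ?thesis using not_WOD_iff[OF C(1)] assms(2) by blast
qed

text \<open>Vertices of \<open>B - D\<close> are left out since they may be adjacent to all of
  \<open>D\<close>.\<close>

lemma non_neighbor_exists:
  assumes "odd (card D)" "D \<subseteq> B" "odd_set G D \<subseteq> B" "B \<subseteq> pverts G"
    and "v \<in> pverts G - (B - D)"
  shows "card ((pverts G - neighborhood G v) \<inter> D) \<ge> 1"
proof -
  have fin: "finite D" using assms finite_subset[OF _ pair_finite_verts] by blast
  have "(pverts G - neighborhood G v) \<inter> D \<noteq> {}"
  proof (cases "v \<in> D")
    case True
    then show ?thesis using not_in_neighborhood assms(5) by blast
  next
    case False
    then have "even (card (neighborhood G v \<inter> D))"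
      using assms by (auto simp: odd_set_def)
    then have "neighborhood G v \<inter> D \<noteq> D" using assms(1) by auto
    then show ?thesis using assms by blast
  qed
  then show ?thesis using fin by (simp add: Suc_le_eq card_gt_0_iff)
qed

section \<open>Counting non-adjacent pairs in a regular graph\<close>

context
  fixes \<delta> :: nat
  assumes regular: "regular G \<delta>"
begin

lemma card_non_neighborhood:
  assumes "v \<in> pverts G"
  shows "card (pverts G - neighborhood G v) = card (pverts G) - \<delta>"
  using assms regular neighborhood_subset[of v]
  by (simp add: card_Diff_subset finite_subset[OF _ pair_finite_verts] card_neighborhood
      regular_def)

lemma degree_less:
  assumes "pverts G \<noteq> {}"
  shows "\<delta> < card (pverts G)"
proof -
  obtain v where v: "v \<in> pverts G" using assms by blast
  then have "neighborhood G v \<subset> pverts G"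
    using neighborhood_subset not_in_neighborhood by blast
  then have "card (neighborhood G v) < card (pverts G)" by (simp add: psubset_card_mono)
  then show ?thesis using v regular by (simp add: card_neighborhood regular_def)
qed

text \<open>Double counting of non-adjacent pairs, regrouped by their member in
  \<open>D\<close>.\<close>

lemma sum_card_non_neighborhood:
  assumes "D \<subseteq> pverts G"
  shows "(\<Sum>v\<in>pverts G. card ((pverts G - neighborhood G v) \<inter> D)) =
    card D * (card (pverts G) - \<delta>)"
proof -
  have eq: "(pverts G - neighborhood G v) \<inter> D = {d \<in> D. d \<notin> neighborhood G v}" for v
    using assms by blast
  have "{v \<in> pverts G. d \<notin> neighborhood G v} = pverts G - neighborhood G d" for d
    by (auto simp: neighborhood_sym[of d])
  then have "\<forall>d\<in>D. card {v \<in> pverts G. d \<notin> neighborhood G v} = card (pverts G) - \<delta>"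
    using card_non_neighborhood assms by auto
  then show ?thesis
    unfolding eq
    using sum_multicount_gen[of "pverts G" D "\<lambda>v d. d \<notin> neighborhood G v"
        "\<lambda>_. card (pverts G) - \<delta>"] finite_subset[OF assms pair_finite_verts]
    by simp
qed

lemma card_pverts_le:
  assumes "odd (card D)" "D \<subseteq> B" "odd_set G D \<subseteq> B" "B \<subseteq> pverts G"
  shows "card (pverts G) \<le> card D * (card (pverts G) - \<delta>) + card (B - D)"
proof -
  have "card (pverts G) - card (B - D) = card (pverts G - (B - D))"
    using assms(4) by (intro card_Diff_subset[symmetric]) (auto intro: finite_subset)
  also have "\<dots> = (\<Sum>v\<in>pverts G - (B - D). 1)" by simp
  also have "\<dots> \<le> (\<Sum>v\<in>pverts G - (B - D). card ((pverts G - neighborhood G v) \<inter> D))"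
    using non_neighbor_exists[OF assms] by (rule sum_mono)
  also have "\<dots> \<le> (\<Sum>v\<in>pverts G. card ((pverts G - neighborhood G v) \<inter> D))"
    by (rule sum_mono2) auto
  also have "\<dots> = card D * (card (pverts G) - \<delta>)"
    using assms by (intro sum_card_non_neighborhood) blast
  finally show ?thesis by simp
qed

lemma card_pverts_le_non_WOD:
  assumes "B \<subseteq> pverts G" "\<not> WOD G B" "pverts G \<noteq> {}"
  shows "card (pverts G) \<le> card B * (card (pverts G) - \<delta>)"
proof -
  obtain D where D: "D \<subseteq> B" "odd (card D)" "odd_set G D \<subseteq> B"
    using assms not_WOD_iff by blast
  have fin: "finite B" using finite_subset[OF assms(1) pair_finite_verts] .
  have B: "card B = card D + card (B - D)"
    using card_Int_Diff[OF fin, of D] D(1) by (simp add: Int_absorb1)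
  \<comment> \<open>Raising the weight of each vertex of \<open>B - D\<close> from one to the
    positive \<open>card (pverts G) - \<delta>\<close> makes the bound depend on
    \<open>card B\<close> alone.\<close>
  have "card (B - D) * 1 \<le> card (B - D) * (card (pverts G) - \<delta>)"
    using degree_less[OF assms(3)] by (intro mult_le_mono2) simp
  with card_pverts_le[OF D(2,1,3) assms(1)] show ?thesis
    unfolding B add_mult_distrib by linarith
qed

lemma perfect_code_complement_if_tight:
  assumes "B \<subseteq> pverts G" "\<not> WOD G B" "pverts G \<noteq> {}"
    and tight: "card (pverts G) = card B * (card (pverts G) - \<delta>)"
  shows "\<exists>C. perfect_code (complement G) C"
proof (cases "card (pverts G) - \<delta> = 1")
  case True
  \<comment> \<open>Weight one would not force \<open>B = D\<close>, but here the complement has no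
    edges and all its vertices form a perfect code.\<close>
  have "(pverts G - neighborhood G v) \<inter> pverts G = pverts G - neighborhood G v" for v by blast
  then have "perfect_code (complement G) (pverts G)"
    using card_non_neighborhood True by (auto simp: perfect_code_complement_iff)
  then show ?thesis by blast
next
  case False
  then have m: "card (pverts G) - \<delta> > 1" using degree_less[OF assms(3)] by simp
  obtain D where D: "D \<subseteq> B" "odd (card D)" "odd_set G D \<subseteq> B"
    using assms not_WOD_iff by blast
  have fin: "finite B" using finite_subset[OF assms(1) pair_finite_verts] .
  have B: "card B = card D + card (B - D)"
    using card_Int_Diff[OF fin, of D] D(1) by (simp add: Int_absorb1)
  have "card (B - D) * (card (pverts G) - \<delta>) \<le> card (B - D)"
    using card_pverts_le[OF D(2,1,3) assms(1)] tight
    unfolding B add_mult_distrib by linarith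
  then have "card (B - D) = 0"
    using m mult_le_cancel1[of "card (B - D)" "card (pverts G) - \<delta>" 1] by auto
  then have "B = D" using D(1) fin by auto
  then have ge: "card ((pverts G - neighborhood G v) \<inter> D) \<ge> 1" if "v \<in> pverts G" for v
    using non_neighbor_exists[OF D(2,1,3) assms(1)] that by blast
  \<comment> \<open>Terms that are all at least one and add up to the number of vertices must all
    equal one.\<close>
  have sum: "(\<Sum>v\<in>pverts G. 1) = (\<Sum>v\<in>pverts G. card ((pverts G - neighborhood G v) \<inter> D))"
    using sum_card_non_neighborhood[OF assms(1)] tight \<open>B = D\<close> by simp
  have "card ((pverts G - neighborhood G v) \<inter> D) = 1" if "v \<in> pverts G" for v
    using sum_mono_inv[OF sum ge that] by simp
  then show ?thesis using assms(1) \<open>B = D\<close> perfect_code_complement_iff by blast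
qed

lemma card_perfect_code_complement:
  assumes "perfect_code (complement G) C"
  shows "card C * (card (pverts G) - \<delta>) = card (pverts G)"
  using assms sum_card_non_neighborhood[of C] by (simp add: perfect_code_complement_iff)

end

section \<open>The minimum size of a non-WOD set and the equivalence\<close>

lemma kappa'_attained:
  assumes "pverts G \<noteq> {}"
  obtains B where "B \<subseteq> pverts G" "\<not> WOD G B" "kappa' G = card B"
proof -
  have "kappa' G \<in> {card B | B. B \<subseteq> pverts G \<and> \<not> WOD G B}"
    unfolding kappa'_def
    using finite_non_WOD_cards[OF pair_finite_verts] not_WOD_pverts[OF assms]
    by (intro Min_in) auto
  then show ?thesis using that by blast
qed

lemma kappa'_le:
  assumes "B \<subseteq> pverts G" "\<not> WOD G B"
  shows "kappa' G \<le> card B"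
  unfolding kappa'_def
  using finite_non_WOD_cards[OF pair_finite_verts] assms by (intro Min_le) auto

end

theorem theorem4:
  fixes G :: "'a pair_pre_digraph" and n \<delta> :: nat
  assumes "pair_graph G"
    and "card (pverts G) = n" and "n \<ge> 1"
    and "regular G \<delta>"
    and "\<exists>k :: int. odd k \<and> real n / (real n - real \<delta>) = of_int k"
  shows "real (kappa' G) = real n / (real n - real \<delta>) \<longleftrightarrow>
         (\<exists>C. perfect_code (complement G) C)"
proof -
  interpret pair_graph G by fact
  note n = assms(2) and reg = assms(4)
  have ne: "pverts G \<noteq> {}" using assms(2,3) by auto
  have less: "\<delta> < n" using degree_less[OF reg ne] n by simp
  then have ratio: "real x = real n / (real n - real \<delta>) \<longleftrightarrow> x * (n - \<delta>) = n" for x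
  proof -
    have "real n - real \<delta> = real (n - \<delta>)" using less by (simp add: of_nat_diff)
    then have "real x = real n / (real n - real \<delta>) \<longleftrightarrow> real (x * (n - \<delta>)) = real n"
      using less by (simp add: eq_divide_eq)
    then show ?thesis by (simp only: of_nat_eq_iff)
  qed
  \<comment> \<open>Carries the integrality hypothesis over to natural numbers; it is applied to the
    size of a perfect code.\<close>
  have odd_ratio: "odd x" if "x * (n - \<delta>) = n" for x
  proof -
    obtain k :: int where "odd k" "real n / (real n - real \<delta>) = of_int k"
      using assms(5) by blast
    with that have "real x = of_int k" using ratio[of x] by simp
    then have "int x = k" by linarith
    then show ?thesis using \<open>odd k\<close> by auto
  qed
  show ?thesis
    unfolding ratio
  proof
    assume "kappa' G * (n - \<delta>) = n"
    moreover obtain B where B: "B \<subseteq> pverts G" "\<not> WOD G B" "kappa' G = card B"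
      using kappa'_attained[OF ne] .
    ultimately show "\<exists>C. perfect_code (complement G) C"
      using perfect_code_complement_if_tight[OF reg B(1,2) ne] n by simp
  next
    assume "\<exists>C. perfect_code (complement G) C"
    then obtain C where C: "perfect_code (complement G) C" by blast
    have card_C: "card C * (n - \<delta>) = n" using card_perfect_code_complement[OF reg C] n by simp
    have "kappa' G \<le> card C"
      using perfect_code_complement_not_WOD[OF C odd_ratio[OF card_C]] C
      by (intro kappa'_le) (auto simp: perfect_code_complement_iff)
    then have "kappa' G * (n - \<delta>) \<le> n" using card_C by (metis mult_le_mono1)
    moreover obtain B where B: "B \<subseteq> pverts G" "\<not> WOD G B" "kappa' G = card B"
      using kappa'_attained[OF ne] .
    ultimately show "kappa' G * (n - \<delta>) = n"
      using card_pverts_le_non_WOD[OF reg B(1,2) ne] n by simp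
  qed
qed

end
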